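(* Let $n\ge 2$, $d\ge 1$, $\tau=1$, and let $\mu^\star_1,\mu^\star_2\stackrel{\mathrm{i.i.d.}}{\sim}\mathcal N(0,I_d)$ and $\xi_1,\dots,\xi_n\stackrel{\mathrm{i.i.d.}}{\sim}\mathcal N(0,\sigma^2 I_d)$, independent, let $z^\star_1,\dots,z^\star_n\in\{1,2\}$ be fixed labels with both classes nonempty, and $x_i=\mu^\star_{z^\star_i}+\xi_i$. Fix $q>1$ and let $\{C_1,C_2\}$ be a fixed $q$-approximately balanced partition of $[n]$, with centroids $\widehat\mu_j=|C_j|^{-1}\sum_{k\in C_j}x_k$. Fix $i\in[n]$, let $j$ be such that $i\in C_j$ and $\overline j$ the other index. Fix $\beta>1$ and suppose $$\sigma=\beta\,\frac{\sqrt n\,q+n-2}{\sqrt2\,\sqrt{\sqrt n\,q+n}}.$$ Then $$\mathbb P\bigl(\|x_i-\widehat\mu_{\overline j}\|^2-\|x_i-\widehat\mu_j\|^2<0\bigr)\le\rho_q^{d/4},$$ where $$\rho_q=\frac{\sigma^2(\sqrt n q+n-2)(\sqrt n q+n)(\sqrt n q+n+2)\bigl(\sqrt n(\sigma^2+2)(\sqrt n+q)-4\bigr)}{\bigl(n\sigma^2(\sqrt n+q)^2+(\sqrt n q+n-2)^2\bigr)^2}.$$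
   Context: A bipartition $\{C_1,C_2\}$ of $[n]=\{1,\dots,n\}$ is $q$-approximately balanced if for $k\in\{1,2\}$, $|C_k|>2$ and $\frac n2-q\sqrt{n/4}<|C_k|<\frac n2+q\sqrt{n/4}$. Randomness is only over the centers and the noise; labels and partition are deterministic. *)

theory Defs
  imports "HOL-Probability.Probability"
begin

text \<open>Vectors in R^d are represented as functions nat => real, only coordinates < d matter.\<close>

definition gauss_vec :: "nat \<Rightarrow> real \<Rightarrow> (nat \<Rightarrow> real) measure" where
  "gauss_vec d s = PiM {..<d} (\<lambda>_. density lborel (normal_density 0 s))"

text \<open>Sample space: pairs (mu, xi); mu 1, mu 2 are the centers ~ N(0, I_d) (tau = 1),
  xi 1, ..., xi n are the noise vectors ~ N(0, sigma^2 I_d), all independent.\<close>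

definition mixture_model :: "nat \<Rightarrow> nat \<Rightarrow> real \<Rightarrow>
    ((nat \<Rightarrow> nat \<Rightarrow> real) \<times> (nat \<Rightarrow> nat \<Rightarrow> real)) measure" where
  "mixture_model n d \<sigma> =
     PiM {1,2} (\<lambda>_. gauss_vec d 1) \<Otimes>\<^sub>M PiM {1..n} (\<lambda>_. gauss_vec d \<sigma>)"

definition sample_x :: "(nat \<Rightarrow> nat) \<Rightarrow> (nat \<Rightarrow> nat \<Rightarrow> real) \<times> (nat \<Rightarrow> nat \<Rightarrow> real)
    \<Rightarrow> nat \<Rightarrow> nat \<Rightarrow> real" where
  "sample_x z \<omega> i l = fst \<omega> (z i) l + snd \<omega> i l"

definition centroid :: "nat set \<Rightarrow> (nat \<Rightarrow> nat \<Rightarrow> real) \<Rightarrow> nat \<Rightarrow> real" where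
  "centroid C x l = (\<Sum>k\<in>C. x k l) / real (card C)"

definition sqdist :: "nat \<Rightarrow> (nat \<Rightarrow> real) \<Rightarrow> (nat \<Rightarrow> real) \<Rightarrow> real" where
  "sqdist d a b = (\<Sum>l<d. (a l - b l)^2)"

definition approx_balanced :: "nat \<Rightarrow> real \<Rightarrow> (nat \<Rightarrow> nat set) \<Rightarrow> bool" where
  "approx_balanced n q C \<longleftrightarrow>
     C 1 \<union> C 2 = {1..n} \<and> C 1 \<inter> C 2 = {} \<and>
     (\<forall>k\<in>{1,2}. card (C k) > 2 \<and>
        real n / 2 - q * sqrt (real n / 4) < real (card (C k)) \<and>
        real (card (C k)) < real n / 2 + q * sqrt (real n / 4))"

definition rho_q :: "nat \<Rightarrow> real \<Rightarrow> real \<Rightarrow> real" where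
  "rho_q n q \<sigma> =
     (let s = sqrt (real n) in
      \<sigma>^2 * (s*q + n - 2) * (s*q + n) * (s*q + n + 2) * (s * (\<sigma>^2 + 2) * (s + q) - 4)
      / (n * \<sigma>^2 * (s + q)^2 + (s*q + n - 2)^2)^2)"

end

theory Submission
  imports Defs
begin

text \<open>
  Every coordinate of $U = x_i - \widehat\mu_{\overline j}$ is a centered Gaussian with some variance
  $u$, every coordinate of $V = x_i - \widehat\mu_j$ one with some variance $v$, and the coordinates
  are independent. Chernoff's bound for $\|V\|^2 - \|U\|^2 > 0$, with the Cauchy-Schwarz inequality
  used to avoid the correlation of $U$ and $V$, leaves two chi-square moment generating functions;
  optimising the exponent gives $(4uv/(u+v)^2)^{d/4}$. With $m = (\sqrt n q + n)/2$ the upper bound on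
  the class sizes, $u \ge a := \sigma^2(1 + 1/m)$ and $v \le b := 2(1-1/m)^2 + \sigma^2(1 - 1/m)$; the
  assumption on $\sigma$ says exactly that $b < a$, and $\rho_q = 4ab/(a+b)^2$.
\<close>

section \<open>Exponential moments of Gaussian squared norms, and the Chernoff bound\<close>

lemma nn_integral_normal_density_exp_square:
  assumes "0 < \<sigma>" "2 * \<theta> * \<sigma>\<^sup>2 < 1"
  shows "(\<integral>\<^sup>+x. ennreal (normal_density 0 \<sigma> x) * ennreal (exp (\<theta> * x\<^sup>2)) \<partial>lborel)
           = ennreal (1 / sqrt (1 - 2 * \<theta> * \<sigma>\<^sup>2))"
proof -
  define r where "r = 1 - 2 * \<theta> * \<sigma>\<^sup>2"
  \<comment> \<open>Tilting the density by \<open>exp (\<theta> * x\<^sup>2)\<close> gives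
    \<open>1 / sqrt r\<close> times another centered normal density, of standard deviation \<tau>,
    so the integral is the total mass \<open>1 / sqrt r\<close>. The sign of \<theta> is free, and
    the Chernoff bound needs both signs.\<close>
  define \<tau> where "\<tau> = \<sigma> / sqrt r"
  have r: "r > 0" using assms by (simp add: r_def)
  have \<tau>: "\<tau> > 0" "\<tau>\<^sup>2 = \<sigma>\<^sup>2 / r" using assms r by (simp_all add: \<tau>_def power_divide)
  have "normal_density 0 \<sigma> x * exp (\<theta> * x\<^sup>2) = 1 / sqrt r * normal_density 0 \<tau> x" for x
  proof -
    have "- x\<^sup>2 / (2 * \<sigma>\<^sup>2) + \<theta> * x\<^sup>2 = - x\<^sup>2 / (2 * \<tau>\<^sup>2)"
      using assms(1) r unfolding \<tau>(2) by (simp add: field_simps r_def)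
    moreover have "1 / sqrt (2 * pi * \<sigma>\<^sup>2) = 1 / sqrt r * (1 / sqrt (2 * pi * \<tau>\<^sup>2))"
      using assms(1) r unfolding \<tau>(2) by (simp add: real_sqrt_mult real_sqrt_divide)
    ultimately show ?thesis
      unfolding normal_density_def by (simp add: exp_add[symmetric] mult.assoc)
  qed
  then have "(\<integral>\<^sup>+x. ennreal (normal_density 0 \<sigma> x) * ennreal (exp (\<theta> * x\<^sup>2)) \<partial>lborel)
      = (\<integral>\<^sup>+x. ennreal (1 / sqrt r) * ennreal (normal_density 0 \<tau> x) \<partial>lborel)"
    using r by (simp add: ennreal_mult'[symmetric])
  also have "\<dots> = ennreal (1 / sqrt r)"
    using \<tau>(1) by (simp add: nn_integral_cmult nn_integral_eq_integral)
  finally show ?thesis by (simp add: r_def)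
qed

text \<open>A summand with coefficient zero has no density. Restricting the sum to the support
  \<open>J\<close> of the coefficients leaves nondegenerate independent normal summands; positivity
  of the total variance makes \<open>J\<close> nonempty.\<close>

lemma (in prob_space) distributed_linear_combination_normal:
  assumes "finite I" "indep_vars (\<lambda>_. borel) X I"
    and s: "\<And>k. k \<in> I \<Longrightarrow> 0 < s k"
    and X: "\<And>k. k \<in> I \<Longrightarrow> distributed M lborel (X k) (normal_density 0 (s k))"
    and pos: "0 < (\<Sum>k\<in>I. (c k * s k)\<^sup>2)"
  shows "distributed M lborel (\<lambda>\<omega>. \<Sum>k\<in>I. c k * X k \<omega>)
           (normal_density 0 (sqrt (\<Sum>k\<in>I. (c k * s k)\<^sup>2)))"
proof -
  define J where "J = {k\<in>I. c k \<noteq> 0}"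
  have J: "finite J" "J \<subseteq> I" using assms(1) by (auto simp: J_def)
  have v: "(\<Sum>k\<in>I. (c k * s k)\<^sup>2) = (\<Sum>k\<in>J. (\<bar>c k\<bar> * s k)\<^sup>2)"
    using assms(1) J(2) by (intro sum.mono_neutral_cong_right) (auto simp: J_def power_mult_distrib)
  have "J \<noteq> {}" using pos unfolding v by auto
  moreover have "indep_vars (\<lambda>_. borel) (\<lambda>k \<omega>. c k * X k \<omega>) J"
    by (rule indep_vars_compose2[OF indep_vars_subset[OF assms(2) J(2)]]) simp
  moreover have "distributed M lborel (\<lambda>\<omega>. c k * X k \<omega>) (normal_density 0 (\<bar>c k\<bar> * s k))"
    if "k \<in> J" for k
    using normal_density_affine[OF X s, of k "c k" 0] that by (auto simp: J_def)
  ultimately have "distributed M lborel (\<lambda>\<omega>. \<Sum>k\<in>J. c k * X k \<omega>)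
      (normal_density (\<Sum>k\<in>J. 0) (sqrt (\<Sum>k\<in>J. (\<bar>c k\<bar> * s k)\<^sup>2)))"
    using J s by (intro sum_indep_normal) (auto simp: J_def)
  moreover have "(\<Sum>k\<in>I. c k * X k \<omega>) = (\<Sum>k\<in>J. c k * X k \<omega>)" for \<omega>
    using assms(1) J(2) by (intro sum.mono_neutral_right) (auto simp: J_def)
  ultimately show ?thesis by (simp add: v)
qed

text \<open>Distinct coordinates \<open>l\<close> use disjoint blocks \<open>K \<times> {l}\<close>
  of variables, so the \<open>d\<close> linear combinations are independent, each normal with
  variance \<open>v\<close>, and the expectation factors into \<open>d\<close> equal one-dimensional
  integrals.\<close>

lemma (in prob_space) nn_integral_exp_gaussian_sqnorm:
  assumes K: "finite K" and ind: "indep_vars (\<lambda>_. borel) X (K \<times> {..<d})"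
    and s: "\<And>k. k \<in> K \<Longrightarrow> 0 < s k"
    and X: "\<And>k l. k \<in> K \<Longrightarrow> l < d \<Longrightarrow> distributed M lborel (X (k, l)) (normal_density 0 (s k))"
    and v: "v = (\<Sum>k\<in>K. (c k * s k)\<^sup>2)" "0 < v" and \<theta>: "2 * \<theta> * v < 1"
  shows "(\<integral>\<^sup>+\<omega>. ennreal (exp (\<theta> * (\<Sum>l<d. (\<Sum>k\<in>K. c k * X (k, l) \<omega>)\<^sup>2))) \<partial>M)
           = ennreal ((1 / sqrt (1 - 2 * \<theta> * v)) ^ d)"
proof -
  define W where "W l \<omega> = (\<Sum>k\<in>K. c k * X (k, l) \<omega>)" for l \<omega>
  have slice: "(\<Sum>p\<in>K \<times> {l}. f p) = (\<Sum>k\<in>K. f (k, l))" for f :: "_ \<Rightarrow> real" and l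
    by (simp add: sum.cartesian_product')
  have W: "distributed M lborel (W l) (normal_density 0 (sqrt v))" if "l < d" for l
  proof -
    have "distributed M lborel (\<lambda>\<omega>. \<Sum>p\<in>K \<times> {l}. c (fst p) * X p \<omega>)
       (normal_density 0 (sqrt (\<Sum>p\<in>K \<times> {l}. (c (fst p) * s (fst p))\<^sup>2)))"
      using that K s X v by (intro distributed_linear_combination_normal indep_vars_subset[OF ind])
        (auto simp: slice)
    then show ?thesis by (simp add: slice v W_def[abs_def])
  qed
  \<comment> \<open>Independence passes first to the blocks, as random elements of product spaces,
    and then to measurable functions of them; \<open>restrict\<close> puts each block into the
    carrier of its product space.\<close>
  have "indep_vars (\<lambda>l. PiM (K \<times> {l}) (\<lambda>_. borel))
          (\<lambda>l \<omega>. restrict (\<lambda>p. X p \<omega>) (K \<times> {l})) {..<d}"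
    by (rule indep_vars_restrict[OF ind]) (auto simp: disjoint_family_on_def)
  then have "indep_vars (\<lambda>_. borel)
      (\<lambda>l \<omega>. ennreal (exp (\<theta> * (\<Sum>k\<in>K. c k * restrict (\<lambda>p. X p \<omega>) (K \<times> {l}) (k, l))\<^sup>2))) {..<d}"
    by (rule indep_vars_compose2[where Y = "\<lambda>l f. ennreal (exp (\<theta> * (\<Sum>k\<in>K. c k * f (k, l))\<^sup>2))"])
      measurable
  then have indW: "indep_vars (\<lambda>_. borel) (\<lambda>l \<omega>. ennreal (exp (\<theta> * (W l \<omega>)\<^sup>2))) {..<d}"
    by (simp add: W_def cong: sum.cong)
  have "(\<integral>\<^sup>+\<omega>. ennreal (exp (\<theta> * (\<Sum>l<d. (W l \<omega>)\<^sup>2))) \<partial>M)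
      = (\<integral>\<^sup>+\<omega>. (\<Prod>l<d. ennreal (exp (\<theta> * (W l \<omega>)\<^sup>2))) \<partial>M)"
    by (simp add: sum_distrib_left exp_sum prod_ennreal)
  also have "\<dots> = (\<Prod>l<d. \<integral>\<^sup>+\<omega>. ennreal (exp (\<theta> * (W l \<omega>)\<^sup>2)) \<partial>M)"
    by (rule indep_vars_nn_integral[OF _ indW]) auto
  also have "\<dots> = (\<Prod>l<d. ennreal (1 / sqrt (1 - 2 * \<theta> * v)))"
  proof (rule prod.cong)
    fix l assume "l \<in> {..<d}"
    then have "(\<integral>\<^sup>+\<omega>. ennreal (exp (\<theta> * (W l \<omega>)\<^sup>2)) \<partial>M)
        = (\<integral>\<^sup>+x. ennreal (normal_density 0 (sqrt v) x) * ennreal (exp (\<theta> * x\<^sup>2)) \<partial>lborel)"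
      by (intro distributed_nn_integral[OF W, symmetric]) auto
    also have "\<dots> = ennreal (1 / sqrt (1 - 2 * \<theta> * v))"
      using nn_integral_normal_density_exp_square[of "sqrt v" \<theta>] v \<theta> by simp
    finally show "(\<integral>\<^sup>+\<omega>. ennreal (exp (\<theta> * (W l \<omega>)\<^sup>2)) \<partial>M) = ennreal (1 / sqrt (1 - 2 * \<theta> * v))" .
  qed simp
  also have "\<dots> = ennreal ((1 / sqrt (1 - 2 * \<theta> * v)) ^ d)"
    using \<theta> by (simp add: ennreal_power)
  finally show ?thesis by (simp add: W_def)
qed

lemma (in prob_space) prob_gaussian_sqnorm_less:
  assumes K: "finite K" and ind: "indep_vars (\<lambda>_. borel) X (K \<times> {..<d})"
    and s: "\<And>k. k \<in> K \<Longrightarrow> 0 < s k"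
    and X: "\<And>k l. k \<in> K \<Longrightarrow> l < d \<Longrightarrow> distributed M lborel (X (k, l)) (normal_density 0 (s k))"
    and u: "u = (\<Sum>k\<in>K. (a k * s k)\<^sup>2)" and v: "v = (\<Sum>k\<in>K. (b k * s k)\<^sup>2)"
    and uv: "0 < v" "v \<le> u"
  shows "prob {\<omega> \<in> space M. (\<Sum>l<d. (\<Sum>k\<in>K. a k * X (k, l) \<omega>)\<^sup>2)
                             < (\<Sum>l<d. (\<Sum>k\<in>K. b k * X (k, l) \<omega>)\<^sup>2)}
           \<le> (4 * u * v / (u + v)\<^sup>2) powr (real d / 4)"
proof -
  define S where "S c \<omega> = (\<Sum>l<d. (\<Sum>k\<in>K. c k * X (k, l) \<omega>)\<^sup>2)" for c \<omega>
  \<comment> \<open>With parameter \<open>t\<close> the squared bound is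
    \<open>((1 - 4*t*v) * (1 + 4*t*u))\<close> to the power \<open>-d/2\<close>; this
    \<open>t\<close> maximises the quadratic in brackets, with value \<open>1 / r\<close>.\<close>
  define t where "t = (u - v) / (8 * u * v)"
  define r where "r = 4 * u * v / (u + v)\<^sup>2"
  have u0: "u > 0" using uv by simp
  have t0: "t \<ge> 0" using uv by (simp add: t_def)
  have r0: "r > 0" using uv u0 by (simp add: r_def)
  have [measurable]: "X (k, l) \<in> borel_measurable M" if "k \<in> K" "l < d" for k l
    using ind that by (auto simp: indep_vars_def)
  have [measurable]: "S c \<in> borel_measurable M" for c
    unfolding S_def by measurable
  let ?E = "{\<omega> \<in> space M. S a \<omega> < S b \<omega>}"
  let ?f = "\<lambda>\<omega>. ennreal (exp (t * S b \<omega>))" and ?g = "\<lambda>\<omega>. ennreal (exp (- t * S a \<omega>))"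
  \<comment> \<open>Cauchy-Schwarz squares both exponential factors, so the moment generating
    functions are taken at \<open>2 * t\<close> and \<open>- 2 * t\<close>.\<close>
  have v': "1 - 2 * (2 * t) * v = (u + v) / (2 * u)" and u': "1 - 2 * (- 2 * t) * u = (u + v) / (2 * v)"
    using uv u0 by (simp_all add: t_def field_simps)
  have sq: "(ennreal (exp x))\<^sup>2 = ennreal (exp (2 * x))" for x
    by (simp add: ennreal_power exp_double)
  have "0 < (u + v) / (2 * u)" "0 < (u + v) / (2 * v)" using uv u0 by simp_all
  then have th: "2 * (2 * t) * v < 1" "2 * (- 2 * t) * u < 1"
    unfolding v'[symmetric] u'[symmetric] by simp_all
  have f2: "(\<integral>\<^sup>+\<omega>. (?f \<omega>)\<^sup>2 \<partial>M) = ennreal ((1 / sqrt ((u + v) / (2 * u))) ^ d)"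
    using nn_integral_exp_gaussian_sqnorm[OF K ind s X v uv(1) th(1)]
    unfolding v' by (simp add: sq S_def mult.assoc)
  have g2: "(\<integral>\<^sup>+\<omega>. (?g \<omega>)\<^sup>2 \<partial>M) = ennreal ((1 / sqrt ((u + v) / (2 * v))) ^ d)"
    using nn_integral_exp_gaussian_sqnorm[OF K ind s X u u0 th(2)]
    unfolding u' by (simp add: sq S_def mult.assoc)
  have "ennreal (prob ?E) = (\<integral>\<^sup>+\<omega>. indicator ?E \<omega> \<partial>M)"
    by (simp add: emeasure_eq_measure)
  also have "\<dots> \<le> (\<integral>\<^sup>+\<omega>. ?f \<omega> * ?g \<omega> \<partial>M)"
  proof (rule nn_integral_mono)
    fix \<omega>
    \<comment> \<open>Chernoff's step: on the event the total exponent is nonnegative, since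
      \<open>v \<le> u\<close> gives \<open>t \<ge> 0\<close>.\<close>
    have "1 \<le> exp (t * S b \<omega>) * exp (- t * S a \<omega>)" if "S a \<omega> < S b \<omega>"
      using that t0 by (simp add: exp_add[symmetric] mult_left_mono)
    then show "indicator ?E \<omega> \<le> ?f \<omega> * ?g \<omega>"
      by (auto simp: indicator_def ennreal_mult'[symmetric] simp flip: ennreal_1)
  qed
  finally have "(ennreal (prob ?E))\<^sup>2 \<le> (\<integral>\<^sup>+\<omega>. ?f \<omega> * ?g \<omega> \<partial>M)\<^sup>2"
    by (rule power_mono) simp
  also have "\<dots> \<le> (\<integral>\<^sup>+\<omega>. (?f \<omega>)\<^sup>2 \<partial>M) * (\<integral>\<^sup>+\<omega>. (?g \<omega>)\<^sup>2 \<partial>M)"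
    by (rule Cauchy_Schwarz_nn_integral) auto
  also have "\<dots> = ennreal ((1 / sqrt ((u + v) / (2 * u))) ^ d * (1 / sqrt ((u + v) / (2 * v))) ^ d)"
    unfolding f2 g2 using uv u0 by (simp add: ennreal_mult')
  finally have "(prob ?E)\<^sup>2 \<le> (1 / sqrt ((u + v) / (2 * u))) ^ d * (1 / sqrt ((u + v) / (2 * v))) ^ d"
    using uv u0 by (simp add: ennreal_power)
  also have "\<dots> = sqrt r ^ d"
  proof -
    have "1 / sqrt x * (1 / sqrt y) = sqrt (1 / (x * y))" for x y
      by (simp add: real_sqrt_mult real_sqrt_divide)
    moreover have "1 / ((u + v) / (2 * u) * ((u + v) / (2 * v))) = r"
      by (simp add: r_def power2_eq_square)
    ultimately show ?thesis by (simp only: power_mult_distrib[symmetric])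
  qed
  \<comment> \<open>The squared probability is bounded with exponent \<open>d/2\<close>; the square
    root required by Cauchy-Schwarz leaves \<open>d/4\<close>.\<close>
  also have "\<dots> = (r powr (real d / 4))\<^sup>2"
    using r0 by (simp add: powr_half_sqrt[symmetric] powr_power)
  finally show ?thesis
    unfolding S_def r_def by (rule power2_le_imp_le) simp
qed

section \<open>The mixture model as one family of independent scalar Gaussians\<close>

text \<open>Index \<^term>\<open>Inl k\<close> stands for the center \<open>k\<close>, index \<^term>\<open>Inr r\<close> for the noise vector \<open>r\<close>.\<close>

definition mix_coord :: "(nat + nat) \<times> nat \<Rightarrow> (nat \<Rightarrow> nat \<Rightarrow> real) \<times> (nat \<Rightarrow> nat \<Rightarrow> real) \<Rightarrow> real" where
  "mix_coord p \<omega> = (case fst p of Inl k \<Rightarrow> fst \<omega> k (snd p) | Inr k \<Rightarrow> snd \<omega> k (snd p))"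

definition mix_index :: "nat \<Rightarrow> (nat + nat) set" where
  "mix_index n = {1, 2} <+> {1..n}"

definition mix_sd :: "real \<Rightarrow> nat + nat \<Rightarrow> real" where
  "mix_sd \<sigma> = case_sum (\<lambda>_. 1) (\<lambda>_. \<sigma>)"

lemma finite_mix_index: "finite (mix_index n)"
  by (simp add: mix_index_def)

lemma mix_sd_pos: "\<sigma> > 0 \<Longrightarrow> 0 < mix_sd \<sigma> k"
  by (simp add: mix_sd_def split: sum.split)

lemma prob_space_gauss_vec: "s > 0 \<Longrightarrow> prob_space (gauss_vec d s)"
  unfolding gauss_vec_def by (intro prob_space_PiM prob_space_normal_density)

lemma space_gauss_vec: "space (gauss_vec d s) = extensional {..<d}"
  by (simp add: gauss_vec_def space_PiM PiE_def)

lemma emeasure_gauss_vec: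
  assumes "s > 0" "\<And>l. l < d \<Longrightarrow> B l \<in> sets borel"
  shows "emeasure (gauss_vec d s) (Pi\<^sub>E {..<d} B)
           = (\<Prod>l<d. emeasure (density lborel (normal_density 0 s)) (B l))"
proof -
  interpret prob_space "density lborel (normal_density 0 s)"
    using assms(1) by (rule prob_space_normal_density)
  interpret P: product_sigma_finite "\<lambda>_::nat. density lborel (normal_density 0 s)"
    by standard
  show ?thesis unfolding gauss_vec_def using assms(2) by (intro P.emeasure_PiM) auto
qed

lemma sets_gauss_vec: "(\<And>l. l < d \<Longrightarrow> B l \<in> sets borel) \<Longrightarrow> Pi\<^sub>E {..<d} B \<in> sets (gauss_vec d s)"
  unfolding gauss_vec_def by (intro sets_PiM_I_finite) auto

lemma emeasure_PiM_gauss_vec: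
  assumes "s > 0" "finite K" "\<And>k l. k \<in> K \<Longrightarrow> l < d \<Longrightarrow> B k l \<in> sets borel"
  shows "emeasure (PiM K (\<lambda>_. gauss_vec d s)) (\<Pi>\<^sub>E k\<in>K. Pi\<^sub>E {..<d} (B k))
           = (\<Prod>k\<in>K. \<Prod>l<d. emeasure (density lborel (normal_density 0 s)) (B k l))"
proof -
  interpret prob_space "gauss_vec d s"
    using assms(1) by (rule prob_space_gauss_vec)
  interpret P: product_sigma_finite "\<lambda>_::'a. gauss_vec d s"
    by standard
  show ?thesis using assms
    by (simp add: P.emeasure_PiM sets_gauss_vec emeasure_gauss_vec)
qed

lemma prob_space_mixture_model: "\<sigma> > 0 \<Longrightarrow> prob_space (mixture_model n d \<sigma>)"
  unfolding mixture_model_def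
  by (intro prob_space_pair prob_space_PiM prob_space_gauss_vec) auto

lemma measurable_mix_coord:
  assumes "k \<in> mix_index n" "l < d"
  shows "mix_coord (k, l) \<in> borel_measurable (mixture_model n d \<sigma>)"
proof -
  have *: "(\<lambda>f. f k l) \<in> borel_measurable (PiM K (\<lambda>_. gauss_vec d s))" if "k \<in> K" for K s and k :: nat
  proof -
    have "(\<lambda>f. f k) \<in> PiM K (\<lambda>_. gauss_vec d s) \<rightarrow>\<^sub>M gauss_vec d s"
      using that by simp
    moreover have "(\<lambda>f. f l) \<in> borel_measurable (gauss_vec d s)"
      using assms(2) unfolding gauss_vec_def by simp
    ultimately show ?thesis by (rule measurable_compose)
  qed
  from assms(1) show ?thesis
    unfolding mixture_model_def mix_coord_def[abs_def] mix_index_def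
    by (auto intro!: measurable_compose[OF measurable_fst *] measurable_compose[OF measurable_snd *])
qed

lemma ball_Plus_Times:
  "(\<forall>p\<in>(K <+> K') \<times> L. P p) \<longleftrightarrow>
     (\<forall>k\<in>K. \<forall>l\<in>L. P (Inl k, l)) \<and> (\<forall>k\<in>K'. \<forall>l\<in>L. P (Inr k, l))"
  by auto

text \<open>A box over the flattened index set is a product of a box of centers and a box of noise
  vectors, each a product of boxes in \<open>R^d\<close>, so the nested product measures factor
  completely. Both the marginal laws and the independence of the coordinates come from this
  formula.\<close>

lemma emeasure_mixture_model_box:
  assumes "\<sigma> > 0" and A: "\<And>p. p \<in> mix_index n \<times> {..<d} \<Longrightarrow> A p \<in> sets borel"
  shows "emeasure (mixture_model n d \<sigma>)
           {\<omega> \<in> space (mixture_model n d \<sigma>). \<forall>p \<in> mix_index n \<times> {..<d}. mix_coord p \<omega> \<in> A p}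
         = (\<Prod>p \<in> mix_index n \<times> {..<d}.
              emeasure (density lborel (normal_density 0 (mix_sd \<sigma> (fst p)))) (A p))"
proof -
  let ?P = "PiM {1, 2::nat} (\<lambda>_. gauss_vec d 1)" and ?Q = "PiM {1..n} (\<lambda>_. gauss_vec d \<sigma>)"
  let ?B = "\<Pi>\<^sub>E k\<in>{1, 2}. \<Pi>\<^sub>E l\<in>{..<d}. A (Inl k, l)"
  let ?D = "\<Pi>\<^sub>E k\<in>{1..n}. \<Pi>\<^sub>E l\<in>{..<d}. A (Inr k, l)"
  interpret Q: prob_space ?Q
    using assms(1) by (intro prob_space_PiM prob_space_gauss_vec)
  have sets: "A (Inl k, l) \<in> sets borel" if "k \<in> {1, 2}" "l < d" for k l
    using A[of "(Inl k, l)"] that by (auto simp: mix_index_def)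
  have sets': "A (Inr k, l) \<in> sets borel" if "k \<in> {1..n}" "l < d" for k l
    using A[of "(Inr k, l)"] that by (simp add: mix_index_def InrI)
  have "{\<omega> \<in> space (mixture_model n d \<sigma>). \<forall>p \<in> mix_index n \<times> {..<d}. mix_coord p \<omega> \<in> A p}
      = ?B \<times> ?D"
  proof (rule set_eqI)
    fix \<omega> :: "(nat \<Rightarrow> nat \<Rightarrow> real) \<times> (nat \<Rightarrow> nat \<Rightarrow> real)"
    obtain f g where \<omega>: "\<omega> = (f, g)" by (cases \<omega>)
    have "(\<forall>p \<in> mix_index n \<times> {..<d}. mix_coord p \<omega> \<in> A p) \<longleftrightarrow>
        (\<forall>k\<in>{1, 2}. \<forall>l\<in>{..<d}. f k l \<in> A (Inl k, l)) \<and> (\<forall>k\<in>{1..n}. \<forall>l\<in>{..<d}. g k l \<in> A (Inr k, l))"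
      unfolding mix_index_def mix_coord_def \<omega> ball_Plus_Times by simp
    \<comment> \<open>Membership in the space supplies exactly the extensionality conditions, at
      both levels of nesting, that distinguish the \<open>PiE\<close> boxes from mere coordinate
      constraints.\<close>
    moreover have "\<omega> \<in> space (mixture_model n d \<sigma>) \<longleftrightarrow>
        (f \<in> extensional {1, 2} \<and> (\<forall>k\<in>{1, 2}. f k \<in> extensional {..<d})) \<and>
        (g \<in> extensional {1..n} \<and> (\<forall>k\<in>{1..n}. g k \<in> extensional {..<d}))"
      unfolding \<omega> mixture_model_def space_pair_measure space_PiM space_gauss_vec PiE_iff mem_Times_iff
        fst_conv snd_conv by blast
    ultimately show "\<omega> \<in> {\<omega> \<in> space (mixture_model n d \<sigma>). \<forall>p \<in> mix_index n \<times> {..<d}. mix_coord p \<omega> \<in> A p}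
        \<longleftrightarrow> \<omega> \<in> ?B \<times> ?D"
      unfolding mem_Collect_eq unfolding \<omega> mem_Times_iff fst_conv snd_conv PiE_iff by blast
  qed
  also have "emeasure (mixture_model n d \<sigma>) \<dots> = emeasure ?P ?B * emeasure ?Q ?D"
    unfolding mixture_model_def
    using sets sets' by (intro Q.emeasure_pair_measure_Times sets_PiM_I_finite sets_gauss_vec) auto
  also have "\<dots> = (\<Prod>k\<in>{1, 2}. \<Prod>l<d. emeasure (density lborel (normal_density 0 1)) (A (Inl k, l)))
      * (\<Prod>k\<in>{1..n}. \<Prod>l<d. emeasure (density lborel (normal_density 0 \<sigma>)) (A (Inr k, l)))"
    using assms(1) sets sets' by (simp only: emeasure_PiM_gauss_vec finite.intros finite_atLeastAtMost zero_less_one)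
  also have "\<dots> = (\<Prod>p \<in> mix_index n \<times> {..<d}.
              emeasure (density lborel (normal_density 0 (mix_sd \<sigma> (fst p)))) (A p))"
    unfolding mix_index_def by (simp only: prod.cartesian_product' prod.Plus finite.intros
        finite_atLeastAtMost comp_def mix_sd_def fst_conv sum.case)
  finally show ?thesis .
qed

lemma distributed_mix_coord:
  assumes "\<sigma> > 0" "k \<in> mix_index n" "l < d"
  shows "distributed (mixture_model n d \<sigma>) lborel (mix_coord (k, l)) (normal_density 0 (mix_sd \<sigma> k))"
proof -
  let ?M = "mixture_model n d \<sigma>" and ?I = "mix_index n \<times> {..<d}"
  let ?N = "\<lambda>p :: (nat + nat) \<times> nat. density lborel (normal_density 0 (mix_sd \<sigma> (fst p)))"
  interpret prob_space ?M using assms(1) by (rule prob_space_mixture_model)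
  have meas: "mix_coord (k, l) \<in> borel_measurable ?M"
    using assms by (intro measurable_mix_coord)
  have N: "emeasure (?N p) UNIV = 1" for p
    using prob_space.emeasure_space_1[OF prob_space_normal_density[OF mix_sd_pos[OF assms(1)]]] by simp
  have "distr ?M lborel (mix_coord (k, l)) = ?N (k, l)"
  proof (rule measure_eqI)
    fix B assume "B \<in> sets (distr ?M lborel (mix_coord (k, l)))"
    then have B: "B \<in> sets borel" by simp
    \<comment> \<open>With \<open>UNIV\<close> at every other coordinate the box is the preimage of
      \<open>B\<close>, and all other factors of the product equal one.\<close>
    define A where "A p = (if p = (k, l) then B else UNIV)" for p
    have "emeasure (distr ?M lborel (mix_coord (k, l))) B
        = emeasure ?M {\<omega> \<in> space ?M. \<forall>p \<in> ?I. mix_coord p \<omega> \<in> A p}"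
      using B meas assms(2,3)
      by (subst emeasure_distr) (auto simp: A_def intro!: arg_cong[where f = "emeasure ?M"])
    also have "\<dots> = (\<Prod>p\<in>?I. emeasure (?N p) (A p))"
      using B assms(1) by (intro emeasure_mixture_model_box) (auto simp: A_def)
    also have "\<dots> = (\<Prod>p\<in>?I. if p = (k, l) then emeasure (?N (k, l)) B else 1)"
      by (intro prod.cong) (simp_all add: A_def N)
    also have "\<dots> = emeasure (?N (k, l)) B"
      using assms(2,3) finite_mix_index by (subst prod.delta) auto
    finally show "emeasure (distr ?M lborel (mix_coord (k, l))) B = emeasure (?N (k, l)) B" .
  qed simp
  then show ?thesis
    using meas by (simp add: distributed_def)
qed

text \<open>The box formula with its factors read as marginal probabilities is the product rule for
  finitely many variables; \<open>d > 0\<close> makes the index set nonempty.\<close>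

lemma indep_vars_mix_coord:
  assumes "\<sigma> > 0" "d > 0"
  shows "prob_space.indep_vars (mixture_model n d \<sigma>) (\<lambda>_. borel) mix_coord (mix_index n \<times> {..<d})"
proof -
  let ?M = "mixture_model n d \<sigma>" and ?I = "mix_index n \<times> {..<d}"
  let ?N = "\<lambda>p :: (nat + nat) \<times> nat. density lborel (normal_density 0 (mix_sd \<sigma> (fst p)))"
  interpret prob_space ?M using assms(1) by (rule prob_space_mixture_model)
  have marginal: "emeasure ?M (mix_coord p -` B \<inter> space ?M) = emeasure (?N p) B"
    if "p \<in> ?I" "B \<in> sets borel" for p B
  proof -
    obtain k l where p: "p = (k, l)" "k \<in> mix_index n" "l < d" using \<open>p \<in> ?I\<close> by auto
    have "emeasure (?N p) B = emeasure (distr ?M lborel (mix_coord p)) B"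
      using distributed_distr_eq_density[OF distributed_mix_coord[OF assms(1) p(2,3)]] by (simp add: p(1))
    also have "\<dots> = emeasure ?M (mix_coord p -` B \<inter> space ?M)"
      using that(2) measurable_mix_coord[OF p(2,3)] by (simp add: emeasure_distr p(1))
    finally show ?thesis ..
  qed
  have ne: "?I \<noteq> {}" "finite ?I"
    using assms(2) finite_mix_index by (auto simp: mix_index_def)
  have "(\<forall>A\<in>(\<Pi> i\<in>?I. sets borel). prob (\<Inter>j\<in>?I. mix_coord j -` A j \<inter> space ?M)
      = (\<Prod>j\<in>?I. prob (mix_coord j -` A j \<inter> space ?M)))"
  proof
    fix A :: "_ \<Rightarrow> real set" assume "A \<in> (\<Pi> i\<in>?I. sets borel)"
    then have A: "A p \<in> sets borel" if "p \<in> ?I" for p using that by auto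
    have "(\<Inter>j\<in>?I. mix_coord j -` A j \<inter> space ?M) = {\<omega> \<in> space ?M. \<forall>p \<in> ?I. mix_coord p \<omega> \<in> A p}"
      using ne(1) by auto
    then have "emeasure ?M (\<Inter>j\<in>?I. mix_coord j -` A j \<inter> space ?M) = (\<Prod>p\<in>?I. emeasure (?N p) (A p))"
      using emeasure_mixture_model_box[OF assms(1) A] by simp
    also have "\<dots> = (\<Prod>p\<in>?I. emeasure ?M (mix_coord p -` A p \<inter> space ?M))"
      using A by (intro prod.cong) (simp_all add: marginal)
    finally show "prob (\<Inter>j\<in>?I. mix_coord j -` A j \<inter> space ?M)
        = (\<Prod>j\<in>?I. prob (mix_coord j -` A j \<inter> space ?M))"
      by (simp add: emeasure_eq_measure prod_ennreal prod_nonneg)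
  qed
  \<comment> \<open>The Borel sets serve as their own intersection-stable generator, so the
    criterion quantifies over precisely the boxes treated above.\<close>
  moreover have "indep_vars (\<lambda>_. borel) mix_coord ?I \<longleftrightarrow>
      (\<forall>A\<in>(\<Pi> i\<in>?I. sets borel). prob (\<Inter>j\<in>?I. mix_coord j -` A j \<inter> space ?M)
        = (\<Prod>j\<in>?I. prob (mix_coord j -` A j \<inter> space ?M)))"
    using ne
  proof (rule indep_vars_finite)
    show "sets borel = sigma_sets (space borel) (sets (borel :: real measure))"
      by (rule sets.sigma_sets_eq[symmetric])
  qed (auto intro!: measurable_mix_coord sets.Int_stable)
  ultimately show ?thesis by simp
qed

section \<open>Monotonicity in the variances, and the algebra of \<open>rho_q\<close> and of the
  noise level\<close>

text \<open>The quantity depends only on the ratio \<open>u / v\<close> and decreases in it beyond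
  1. After clearing denominators the difference factors as
  \<open>(u * b - v * a) * (u * a - v * b)\<close>, with both factors nonnegative.\<close>

lemma four_mult_div_square_sum_mono:
  fixes a b u v :: real
  assumes "0 < v" "v \<le> b" "b \<le> a" "a \<le> u"
  shows "4 * u * v / (u + v)\<^sup>2 \<le> 4 * a * b / (a + b)\<^sup>2"
proof -
  have "a * v \<le> u * b" using assms by (intro mult_mono) auto
  then have "v * a \<le> u * b" by (simp add: mult.commute)
  moreover have "v * b \<le> u * a" using assms by (intro mult_mono) auto
  ultimately have "0 \<le> (u * b - v * a) * (u * a - v * b)" by simp
  also have "\<dots> = a * b * (u + v)\<^sup>2 - u * v * (a + b)\<^sup>2"
    by (simp add: algebra_simps power2_eq_square)
  finally show ?thesis using assms by (simp add: divide_simps)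
qed

text \<open>Everything reduces to \<open>m\<close> because \<open>s * q + n\<close> and
  \<open>s * (s + q)\<close> both equal \<open>2 * m\<close>. The numerator is then
  \<open>16 * m^4 * a * b\<close> and the denominator
  \<open>4 * m^4 * (a + b)\<^sup>2\<close>.\<close>

lemma rho_q_eq:
  fixes q \<sigma> :: real and n :: nat
  defines "m \<equiv> (sqrt (real n) * q + real n) / 2"
  assumes "m > 1"
  defines "a \<equiv> \<sigma>\<^sup>2 * (1 + 1 / m)" and "b \<equiv> 2 * (1 - 1 / m)\<^sup>2 + \<sigma>\<^sup>2 * (1 - 1 / m)"
  shows "rho_q n q \<sigma> = 4 * a * b / (a + b)\<^sup>2"
proof -
  define s where "s = sqrt (real n)"
  have n: "real n = s * s" by (simp add: s_def)
  have sq: "s * q = 2 * m - real n" by (simp add: s_def m_def field_simps)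
  have ss: "s * (s + q) = 2 * m" by (simp add: distrib_left sq n)
  have "real n * \<sigma>\<^sup>2 * (s + q)\<^sup>2 = \<sigma>\<^sup>2 * (s * (s + q))\<^sup>2"
    unfolding n by (simp add: power2_eq_square)
  then have den: "real n * \<sigma>\<^sup>2 * (s + q)\<^sup>2 = 4 * m\<^sup>2 * \<sigma>\<^sup>2" unfolding ss by (simp add: power2_eq_square)
  have num: "s * (\<sigma>\<^sup>2 + 2) * (s + q) = 2 * m * (\<sigma>\<^sup>2 + 2)"
    by (metis ss mult.assoc mult.commute)
  have "rho_q n q \<sigma> = \<sigma>\<^sup>2 * (2 * m - 2) * (2 * m) * (2 * m + 2) * (2 * m * (\<sigma>\<^sup>2 + 2) - 4)
      / (4 * m\<^sup>2 * \<sigma>\<^sup>2 + (2 * m - 2)\<^sup>2)\<^sup>2"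
    unfolding rho_q_def Let_def s_def[symmetric] den num sq by simp
  also have "4 * m\<^sup>2 * \<sigma>\<^sup>2 + (2 * m - 2)\<^sup>2 = 2 * m\<^sup>2 * (a + b)"
    using assms(2) by (simp add: a_def b_def field_simps power2_eq_square)
  also have "\<sigma>\<^sup>2 * (2 * m - 2) * (2 * m) * (2 * m + 2) * (2 * m * (\<sigma>\<^sup>2 + 2) - 4) = 16 * m ^ 4 * (a * b)"
    using assms(2) by (simp add: a_def b_def field_simps power2_eq_square power4_eq_xxxx)
  finally show ?thesis
    using assms(2) by (simp add: power_mult_distrib)
qed

text \<open>The two sides agree when \<open>\<sigma>\<^sup>2 = (m - 1)\<^sup>2 / m\<close>, which is
  the case \<beta> = 1 of the formula for \<sigma>; their gap is \<open>2 / m\<close> times the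
  excess of \<open>\<sigma>\<^sup>2\<close> over that value.\<close>

lemma noise_threshold:
  fixes m \<beta> \<sigma> :: real
  assumes "m > 1" "\<beta> > 1" and \<sigma>: "\<sigma> = \<beta> * (2 * m - 2) / (sqrt 2 * sqrt (2 * m))"
  shows "2 * (1 - 1 / m)\<^sup>2 + \<sigma>\<^sup>2 * (1 - 1 / m) \<le> \<sigma>\<^sup>2 * (1 + 1 / m)"
proof -
  have "\<sigma>\<^sup>2 = \<beta>\<^sup>2 * ((m - 1)\<^sup>2 / m)"
    using assms(1) by (simp add: \<sigma> power_divide power_mult_distrib field_simps power2_eq_square)
  moreover have "1 * ((m - 1)\<^sup>2 / m) \<le> \<beta>\<^sup>2 * ((m - 1)\<^sup>2 / m)"
    using assms by (intro mult_right_mono) auto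
  ultimately have "0 \<le> 2 / m * (\<sigma>\<^sup>2 - (m - 1)\<^sup>2 / m)"
    using assms(1) by (intro mult_nonneg_nonneg) auto
  also have "\<dots> = \<sigma>\<^sup>2 * (1 + 1 / m) - (2 * (1 - 1 / m)\<^sup>2 + \<sigma>\<^sup>2 * (1 - 1 / m))"
    using assms(1) by (simp add: field_simps power2_eq_square)
  finally show "2 * (1 - 1 / m)\<^sup>2 + \<sigma>\<^sup>2 * (1 - 1 / m) \<le> \<sigma>\<^sup>2 * (1 + 1 / m)"
    by simp
qed

section \<open>Coefficients and variances of a sample minus a centroid\<close>

text \<open>The coefficients of $x_i$ minus the centroid of \<open>C\<close> as a linear combination of centers and noise.\<close>

definition diff_coeff :: "(nat \<Rightarrow> nat) \<Rightarrow> nat \<Rightarrow> nat set \<Rightarrow> nat + nat \<Rightarrow> real" where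
  "diff_coeff z i C p = (case p of
      Inl k \<Rightarrow> of_bool (z i = k) - real (card {r\<in>C. z r = k}) / real (card C)
    | Inr r \<Rightarrow> of_bool (r = i) - of_bool (r \<in> C) / real (card C))"

lemma sum_mix_index: "(\<Sum>k\<in>mix_index n. f k) = f (Inl 1) + f (Inl 2) + (\<Sum>r\<in>{1..n}. f (Inr r))"
  for f :: "_ \<Rightarrow> real"
  by (simp add: mix_index_def sum.Plus)

lemma sample_x_minus_centroid:
  assumes z: "\<forall>k\<in>{1..n}. z k \<in> {1, 2}" and i: "i \<in> {1..n}" and C: "C \<subseteq> {1..n}"
  shows "sample_x z \<omega> i l - centroid C (sample_x z \<omega>) l
           = (\<Sum>k\<in>mix_index n. diff_coeff z i C k * mix_coord (k, l) \<omega>)"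
proof -
  have fin: "finite C" using C finite_subset by blast
  \<comment> \<open>Indicator weights replace the label lookup by a sum over both centers; summing
    over \<open>C\<close> then turns the weights into counts of labels.\<close>
  have center: "fst \<omega> (z r) l = (\<Sum>k\<in>{1, 2}. of_bool (z r = k) * fst \<omega> k l)" if "r \<in> {1..n}" for r
    using z that by auto
  have "(\<Sum>r\<in>C. fst \<omega> (z r) l) = (\<Sum>r\<in>C. \<Sum>k\<in>{1, 2}. of_bool (z r = k) * fst \<omega> k l)"
    using C by (intro sum.cong center) auto
  also have "\<dots> = (\<Sum>k\<in>{1, 2}. \<Sum>r\<in>C. of_bool (z r = k) * fst \<omega> k l)"
    by (rule sum.swap)
  also have "\<dots> = (\<Sum>k\<in>{1, 2}. real (card {r\<in>C. z r = k}) * fst \<omega> k l)"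
    using fin by (simp add: sum_distrib_right[symmetric] sum.If_cases of_bool_def Int_def)
  finally have centers: "(\<Sum>r\<in>C. fst \<omega> (z r) l) = \<dots>" .
  have noise: "(\<Sum>r\<in>C. snd \<omega> r l) = (\<Sum>r\<in>{1..n}. of_bool (r \<in> C) * snd \<omega> r l)"
    using C by (intro sum.mono_neutral_cong_left) auto
  have self: "snd \<omega> i l = (\<Sum>r\<in>{1..n}. of_bool (r = i) * snd \<omega> r l)"
    using i by (simp add: of_bool_def if_distrib[of "\<lambda>x. x * _"] sum.delta cong: if_cong)
  have "sample_x z \<omega> i l - centroid C (sample_x z \<omega>) l
      = (\<Sum>k\<in>{1, 2}. of_bool (z i = k) * fst \<omega> k l)
        - (\<Sum>k\<in>{1, 2}. real (card {r\<in>C. z r = k}) * fst \<omega> k l) / real (card C)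
        + ((\<Sum>r\<in>{1..n}. of_bool (r = i) * snd \<omega> r l)
        - (\<Sum>r\<in>{1..n}. of_bool (r \<in> C) * snd \<omega> r l) / real (card C))"
    unfolding sample_x_def centroid_def sum.distrib centers noise add_divide_distrib
      center[OF i] self by simp
  also have "\<dots> = (\<Sum>k\<in>mix_index n. diff_coeff z i C k * mix_coord (k, l) \<omega>)"
    unfolding sum_mix_index sum_divide_distrib sum_subtractf[symmetric]
    by (simp add: diff_coeff_def mix_coord_def algebra_simps add_divide_distrib)
  finally show ?thesis .
qed

text \<open>The square of \<open>of_bool (r = i) - of_bool (r \<in> C) / m\<close> has a cross term
  only at \<open>r = i\<close>, and only if \<open>i \<in> C\<close>. Hence the correction is
  \<open>1/m\<close> for a foreign cluster and \<open>-1/m\<close> for the own cluster; this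
  asymmetry drives the final bound.\<close>

lemma noise_variance:
  assumes "i \<in> {1..n}" "C \<subseteq> {1..n}" "card C > 0"
  shows "(\<Sum>r\<in>{1..n}. (diff_coeff z i C (Inr r))\<^sup>2) = 1 + (1 - 2 * of_bool (i \<in> C)) / real (card C)"
proof -
  let ?m = "real (card C)"
  have "(\<Sum>r\<in>{1..n}. (diff_coeff z i C (Inr r))\<^sup>2)
      = (\<Sum>r\<in>{1..n}. (if r = i then 1 - 2 * of_bool (i \<in> C) / ?m else 0) + (if r \<in> C then 1 / ?m\<^sup>2 else 0))"
    by (intro sum.cong) (auto simp: diff_coeff_def power2_diff power_divide)
  also have "\<dots> = 1 - 2 * of_bool (i \<in> C) / ?m + (\<Sum>r\<in>{1..n}. if r \<in> C then 1 / ?m\<^sup>2 else 0)"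
    using assms(1) by (simp add: sum.distrib)
  also have "(\<Sum>r\<in>{1..n}. if r \<in> C then 1 / ?m\<^sup>2 else 0) = (\<Sum>r\<in>C. 1 / ?m\<^sup>2)"
    using assms(2) by (intro sum.mono_neutral_cong_right) auto
  also have "\<dots> = 1 / ?m"
    using assms(3) by (simp add: power2_eq_square)
  finally show ?thesis by (simp add: diff_divide_distrib)
qed

text \<open>Since \<open>i\<close> itself lies in \<open>C\<close>, at least one member carries the
  label \<open>z i\<close>. So the coefficient of that center is at most
  \<open>1 - 1 / card C\<close>, and the other label occurs at most \<open>card C - 1\<close>
  times.\<close>

lemma center_coeff_le:
  assumes z: "\<forall>k\<in>C. z k \<in> {1, 2}" and C: "finite C" "i \<in> C" and k: "k \<in> {1, 2}"
  shows "(diff_coeff z i C (Inl k))\<^sup>2 \<le> (1 - 1 / real (card C))\<^sup>2"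
proof -
  let ?c = "\<lambda>k. card {r\<in>C. z r = k}"
  have m: "card C > 0" using C by (auto simp: card_gt_0_iff)
  have pos: "0 < ?c (z i)" using C by (auto simp: card_gt_0_iff)
  have split: "?c (z i) + ?c k \<le> card C" if "k \<noteq> z i"
    using that C by (subst card_Un_disjoint[symmetric]) (auto intro!: card_mono)
  have le: "?c k \<le> card C" using C by (intro card_mono) auto
  have "\<bar>diff_coeff z i C (Inl k)\<bar> \<le> \<bar>1 - 1 / real (card C)\<bar>"
  proof (cases "z i = k")
    case True
    have "1 \<le> real (?c k)" "real (?c k) \<le> card C" using pos le True by auto
    then show ?thesis using m True by (simp add: diff_coeff_def abs_real_def field_simps)
  next
    case False
    then have "1 + real (?c k) \<le> card C" using split pos by linarith
    then show ?thesis using m False by (simp add: diff_coeff_def abs_real_def field_simps)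
  qed
  then show ?thesis by (simp add: abs_le_square_iff)
qed

section \<open>Variance bounds for a balanced partition and the resulting probability bound\<close>

theorem theorem3p6:
  fixes n d :: nat and q \<beta> \<sigma> :: real and z :: "nat \<Rightarrow> nat"
    and C :: "nat \<Rightarrow> nat set" and i j :: nat
  assumes "n \<ge> 2" and "d \<ge> 1"
    and "\<forall>k\<in>{1..n}. z k \<in> {1,2}"
    and "\<exists>k\<in>{1..n}. z k = 1" and "\<exists>k\<in>{1..n}. z k = 2"
    and "q > 1" and "approx_balanced n q C"
    and "i \<in> {1..n}" and "j \<in> {1,2}" and "i \<in> C j"
    and "\<beta> > 1"
    and "\<sigma> = \<beta> * (sqrt (real n) * q + real n - 2)
                 / (sqrt 2 * sqrt (sqrt (real n) * q + real n))"
  shows "measure (mixture_model n d \<sigma>)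
           {\<omega> \<in> space (mixture_model n d \<sigma>).
              sqdist d (sample_x z \<omega> i) (centroid (C (3 - j)) (sample_x z \<omega>))
              - sqdist d (sample_x z \<omega> i) (centroid (C j) (sample_x z \<omega>)) < 0}
         \<le> rho_q n q \<sigma> powr (real d / 4)"
proof -
  let ?M = "mixture_model n d \<sigma>"
  define m where "m = (sqrt (real n) * q + real n) / 2"
  have j: "j \<in> {1, 2}" "3 - j \<in> {1, 2}" "3 - j \<noteq> j" using assms(9) by auto
  have sub: "C k \<subseteq> {1..n}" if "k \<in> {1, 2}" for k
    using assms(7) that unfolding approx_balanced_def by blast
  have disj: "i \<notin> C (3 - j)"
    using assms(7,9,10) unfolding approx_balanced_def by auto
  \<comment> \<open>As \<open>sqrt (n / 4)\<close> is \<open>sqrt n / 2\<close>, the upper balance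
    condition reads \<open>card (C k) < m\<close>.\<close>
  have card: "card (C k) > 2" "real (card (C k)) < m" if "k \<in> {1, 2}" for k
    using assms(7) that unfolding approx_balanced_def m_def
    by (force simp: real_sqrt_divide field_simps)+
  have m: "m > 1" using card[OF j(1)] by linarith
  have \<sigma>: "\<sigma> = \<beta> * (2 * m - 2) / (sqrt 2 * sqrt (2 * m))"
    proof -
    have "2 * m = sqrt (real n) * q + real n" by (simp add: m_def field_simps)
    then show ?thesis using assms(12) by simp
  qed
  have \<sigma>_pos: "\<sigma> > 0" using m assms(11) by (simp add: \<sigma>)
  define a where "a = diff_coeff z i (C (3 - j))"
  define b where "b = diff_coeff z i (C j)"
  define u where "u = (\<Sum>k\<in>mix_index n. (a k * mix_sd \<sigma> k)\<^sup>2)"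
  define v where "v = (\<Sum>k\<in>mix_index n. (b k * mix_sd \<sigma> k)\<^sup>2)"
  let ?a = "\<sigma>\<^sup>2 * (1 + 1 / m)" and ?b = "2 * (1 - 1 / m)\<^sup>2 + \<sigma>\<^sup>2 * (1 - 1 / m)"
  have var: "(\<Sum>k\<in>mix_index n. (c k * mix_sd \<sigma> k)\<^sup>2)
      = (c (Inl 1))\<^sup>2 + (c (Inl 2))\<^sup>2 + \<sigma>\<^sup>2 * (\<Sum>r\<in>{1..n}. (c (Inr r))\<^sup>2)" for c
    by (simp add: sum_mix_index mix_sd_def power_mult_distrib sum_distrib_left mult.commute)
  have u_eq: "u = (a (Inl 1))\<^sup>2 + (a (Inl 2))\<^sup>2 + \<sigma>\<^sup>2 * (1 + 1 / real (card (C (3 - j))))"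
    unfolding u_def var unfolding a_def
    using noise_variance[OF assms(8) sub[OF j(2)]] card(1)[OF j(2)] disj by simp
  have v_eq: "v = (b (Inl 1))\<^sup>2 + (b (Inl 2))\<^sup>2 + \<sigma>\<^sup>2 * (1 - 1 / real (card (C j)))"
    unfolding v_def var unfolding b_def
    using noise_variance[OF assms(8) sub[OF j(1)]] card(1)[OF j(1)] assms(10) by simp
  have inv: "1 / m \<le> 1 / real (card (C k))" "1 / real (card (C k)) < 1" if "k \<in> {1, 2}" for k
    using card[OF that] m by (auto simp: frac_le)
  \<comment> \<open>The center coefficients may all vanish, for instance when \<open>C j\<close>
    carries a single label, so positivity of \<open>v\<close> is taken from the noise.\<close>
  have "0 < \<sigma>\<^sup>2 * (1 - 1 / real (card (C j)))" using inv(2)[OF j(1)] \<sigma>_pos by simp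
  then have v_pos: "0 < v" unfolding v_eq by (intro add_nonneg_pos) auto
  \<comment> \<open>For the foreign cluster the squared center coefficients are bounded below by
    zero; only the noise part is kept.\<close>
  have u_ge: "?a \<le> u"
  proof -
    have "?a \<le> \<sigma>\<^sup>2 * (1 + 1 / real (card (C (3 - j))))"
      using inv(1)[OF j(2)] by (intro mult_left_mono) auto
    then show ?thesis unfolding u_eq by (simp add: add_increasing)
  qed
  \<comment> \<open>Each of the two centers contributes at most \<open>(1 - 1 / m)\<^sup>2\<close>
    to \<open>v\<close>, which explains the factor 2 in \<open>?b\<close>.\<close>
  have center: "(b (Inl k))\<^sup>2 \<le> (1 - 1 / m)\<^sup>2" if "k \<in> {1, 2}" for k
  proof -
    have "(b (Inl k))\<^sup>2 \<le> (1 - 1 / real (card (C j)))\<^sup>2"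
      unfolding b_def using sub[OF j(1)] assms(3,10) that
      by (intro center_coeff_le) (auto intro: finite_subset)
    also have "\<dots> \<le> (1 - 1 / m)\<^sup>2"
      using inv[OF j(1)] by (intro power_mono) auto
    finally show ?thesis .
  qed
  have "\<sigma>\<^sup>2 * (1 - 1 / real (card (C j))) \<le> \<sigma>\<^sup>2 * (1 - 1 / m)"
    using inv(1)[OF j(1)] by (intro mult_left_mono) auto
  then have v_le: "v \<le> ?b" using center[of 1] center[of 2] unfolding v_eq by simp
  have b_le_a: "?b \<le> ?a" by (rule noise_threshold[OF m assms(11) \<sigma>])
  interpret prob_space ?M using \<sigma>_pos by (rule prob_space_mixture_model)
  \<comment> \<open>The event says that the squared norm with coefficients \<open>a\<close> is below
    the one with coefficients \<open>b\<close>; the chain \<open>v \<le> ?b \<le> ?a \<le> u\<close>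
    supplies the required order of the variances.\<close>
  have "prob {\<omega> \<in> space ?M. (\<Sum>l<d. (\<Sum>k\<in>mix_index n. a k * mix_coord (k, l) \<omega>)\<^sup>2)
                             < (\<Sum>l<d. (\<Sum>k\<in>mix_index n. b k * mix_coord (k, l) \<omega>)\<^sup>2)}
      \<le> (4 * u * v / (u + v)\<^sup>2) powr (real d / 4)"
    using \<sigma>_pos assms(2) v_pos v_le b_le_a u_ge
    by (intro prob_gaussian_sqnorm_less[where s = "mix_sd \<sigma>"] indep_vars_mix_coord distributed_mix_coord)
      (auto simp: finite_mix_index mix_sd_pos u_def v_def)
  also have "\<dots> \<le> (4 * ?a * ?b / (?a + ?b)\<^sup>2) powr (real d / 4)"
    using v_pos v_le b_le_a u_ge by (intro powr_mono2 four_mult_div_square_sum_mono) auto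
  also have "4 * ?a * ?b / (?a + ?b)\<^sup>2 = rho_q n q \<sigma>"
    using m unfolding m_def by (rule rho_q_eq[symmetric])
  finally show ?thesis
    unfolding sqdist_def a_def b_def sample_x_minus_centroid[OF assms(3,8) sub[OF j(1)]]
      sample_x_minus_centroid[OF assms(3,8) sub[OF j(2)]] by simp
qed

end
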